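(* The first few terms of the Taylor series about $0$ of the logarithmic Lambert function $W_{\mathcal{L}}(x)$ (with constant $B$) are $$W_{\mathcal{L}}(x)=\frac{1}{B}+e^{-\frac{1}{B}}x+\frac{2+B}{2!}e^{-\frac{2}{B}}x^2+\frac{(4B^2+9B+9)e^{-\frac{3}{B}}}{3!}x^3+\cdots .$$
   Context: For any real number $x$ and constant $B$, the logarithmic Lambert function $y=W_{\mathcal{L}}(x)$ is defined to be the solution $y$ of the equation $y\ln(By)e^{y}=x$; here $y$ cannot be zero and $By$ must be positive. Thus $W_{\mathcal{L}}$ is the inverse of the function $f(y)=y\ln(By)e^{y}$, and the expansion is the one of this inverse around the point $y=\frac1B$, where $f\left(\frac1B\right)=0$.
   Formalization: The coefficient of x² is stated with a minus sign, −(2+B)e^{−2/B}/2!, because the printed plus sign is false for every B ≠ −2; B is taken to be a nonzero real constant. *)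

theory Defs
  imports "HOL-Analysis.Analysis"
begin

definition log_lambert_fun :: "real \<Rightarrow> real \<Rightarrow> real" where
  "log_lambert_fun B y = y * ln (B * y) * exp y"

(* The equation y ln (B y) e^y = x has in general several solutions y for the same x close to 0
   (for B > 0 and small x < 0 there is one near 1/B and one near 0), so that it determines a
   function only once a branch is chosen.  The branch is the one expanded around y = 1/B:
   W solves the equation for all x near 0, with W x close to 1/B for x close to 0.  The filter
   is nhds 0, not at 0, so x = 0 is included and W 0 = 1/B follows.  Nothing is required of W
   away from 0.  The side condition B y > 0 is explicit because ln is total in HOL. *)
definition is_log_lambert :: "real \<Rightarrow> (real \<Rightarrow> real) \<Rightarrow> bool" where
  "is_log_lambert B W \<longleftrightarrow>
     (\<forall>\<^sub>F x in nhds 0. W x \<noteq> 0 \<and> B * W x > 0 \<and> log_lambert_fun B (W x) = x) \<and>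
     (W \<longlongrightarrow> 1 / B) (nhds 0)"

definition taylor_coeff :: "(real \<Rightarrow> real) \<Rightarrow> nat \<Rightarrow> real" where
  "taylor_coeff g n = (deriv ^^ n) g 0 / fact n"

(* Sign of the quadratic coefficient of W: with f = log_lambert_fun B one has
   f'(1/B) = e^(1/B) and f''(1/B) = (2 + B) e^(1/B), hence
   W''(0) = - f''(1/B) / f'(1/B)^3 = - (2 + B) e^(-2/B).
   The formula is also found in print with + (2 + B) e^(-2/B), which is a misprint
   (it is wrong for every B except B = -2). *)

end

theory Submission
  imports Defs "HOL-Complex_Analysis.Complex_Analysis"
begin

text \<open>
  Write \<open>f y = y ln (B y) e\<^sup>y\<close> and \<open>a = 1 / B\<close>, so that \<open>f a = 0\<close> and \<open>f' a = e\<^sup>a \<noteq> 0\<close>.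
  Two facts about the local inverse of \<open>f\<close> at \<open>a\<close> are needed: it is analytic, so that its Taylor
  series converges to it, and its first three derivatives at \<open>0\<close> have the stated values.

  Analyticity is obtained by passing to the complex function \<open>F z = z Ln (B z) e\<^sup>z\<close> on the half plane
  \<open>Re (B z) > 0\<close>.  As \<open>F' a \<noteq> 0\<close>, \<open>F\<close> has a holomorphic inverse \<open>G\<close> near \<open>0\<close>.
  Moreover \<open>F\<close> commutes with complex conjugation and is injective near \<open>a\<close>; hence \<open>G\<close> is real on
  the real axis near \<open>0\<close> (lemma \<open>holomorphic_real_inverse\<close>).  The function \<open>x \<mapsto> Re (G x)\<close> is thus a branch
  of the logarithmic Lambert function.  Conversely, every branch \<open>W\<close> stays near \<open>a\<close>
  for small arguments, and so coincides with the restriction of \<open>G\<close> near \<open>0\<close>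
  (lemma \<open>log_lambert_holomorphic_branch\<close>).  Since differentiation along
  the real axis commutes with taking real parts, the Taylor series of \<open>W\<close> is the real part of
  the one of \<open>G\<close>, which converges on a disc.

  For the coefficients, differentiating \<open>f (W x) = x\<close> gives \<open>W' = 1 / f' (W)\<close> near \<open>0\<close>, and
  differentiating this twice more expresses \<open>W''\<close> and \<open>W'''\<close> by the derivatives of \<open>f\<close>
  (lemma \<open>higher_derivs_local_inverse\<close>).  It remains to insert
  \<open>f' a = e\<^sup>a\<close>, \<open>f'' a = (2 + B) e\<^sup>a\<close> and \<open>f''' a = (3 + 3 B - B\<^sup>2) e\<^sup>a\<close>.
\<close>

section \<open>Restricting holomorphic functions to the real axis\<close>

lemma has_real_derivative_Re_of_real:
  assumes "(H has_field_derivative D) (at (complex_of_real x))"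
  shows "((\<lambda>x. Re (H (of_real x))) has_real_derivative Re D) (at x)"
proof -
  have "((\<lambda>x. H (of_real x)) has_vector_derivative D) (at x)"
    using assms by (rule has_vector_derivative_real_field)
  then have "((\<lambda>x. Re (H (of_real x))) has_vector_derivative Re D) (at x)"
    by (rule bounded_linear.has_vector_derivative [OF bounded_linear_Re])
  then show ?thesis
    by (simp add: has_real_derivative_iff_has_vector_derivative)
qed

lemma higher_deriv_Re_of_real:
  assumes "G holomorphic_on S" "open S" "complex_of_real x \<in> S"
  shows "(deriv ^^ n) (\<lambda>x. Re (G (of_real x))) x = Re ((deriv ^^ n) G (of_real x))"
  using assms(3)
proof (induction n arbitrary: x)
  case (Suc n)
  have "open (complex_of_real -` S)"
    using \<open>open S\<close> by (intro open_vimage continuous_intros)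
  then have "eventually (\<lambda>y. y \<in> complex_of_real -` S) (nhds x)"
    using Suc.prems by (intro eventually_nhds_in_open) auto
  then have ev: "eventually (\<lambda>y. (deriv ^^ n) (\<lambda>x. Re (G (of_real x))) y
                   = Re ((deriv ^^ n) G (of_real y))) (nhds x)"
    by eventually_elim (use Suc.IH in auto)
  have "((deriv ^^ n) G has_field_derivative (deriv ^^ Suc n) G (of_real x)) (at (of_real x))"
    using holomorphic_derivI [OF holomorphic_higher_deriv [OF assms(1,2)] \<open>open S\<close> Suc.prems]
    by simp
  then have "deriv (\<lambda>y. Re ((deriv ^^ n) G (of_real y))) x = Re ((deriv ^^ Suc n) G (of_real x))"
    by (intro DERIV_imp_deriv has_real_derivative_Re_of_real)
  with deriv_cong_ev [OF ev refl] show ?case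
    by simp
qed simp

text \<open>
  For real \<open>x\<close> the powers \<open>x ^ n\<close> are real, so the real part of the complex Taylor series is a real
  power series; its coefficients are Taylor coefficients by the preceding lemma.
\<close>

lemma taylor_sums_Re_of_real:
  assumes "G holomorphic_on ball 0 r" "\<bar>x\<bar> < r"
  shows "(\<lambda>n. taylor_coeff (\<lambda>x. Re (G (of_real x))) n * x ^ n) sums Re (G (of_real x))"
proof -
  have "complex_of_real x \<in> ball 0 r" "complex_of_real 0 \<in> ball 0 r"
    using assms(2) by auto
  then have "(\<lambda>n. Re ((deriv ^^ n) G 0 / fact n * (of_real x - 0) ^ n)) sums Re (G (of_real x))"
    by (intro sums_Re holomorphic_power_series [OF assms(1)])
  moreover have "Re ((deriv ^^ n) G 0 / fact n * (of_real x - 0) ^ n)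
      = taylor_coeff (\<lambda>x. Re (G (of_real x))) n * x ^ n" for n
  proof -
    have "(deriv ^^ n) G 0 / fact n * (of_real x - 0) ^ n
        = (deriv ^^ n) G 0 * of_real (x ^ n / fact n)"
      by simp
    then have "Re ((deriv ^^ n) G 0 / fact n * (of_real x - 0) ^ n)
        = Re ((deriv ^^ n) G 0) * (x ^ n / fact n)"
      by (simp only: Re_complex_of_real Im_complex_of_real times_complex.sel mult_zero_right diff_zero)
    then show ?thesis
      using higher_deriv_Re_of_real [OF assms(1) open_ball \<open>complex_of_real 0 \<in> ball 0 r\<close>, of n]
      by (simp add: taylor_coeff_def)
  qed
  ultimately show ?thesis
    by simp
qed

section \<open>Local inverses\<close>

text \<open>
  On a ball around a real centre on which \<open>f\<close> is injective, \<open>cnj w\<close> and \<open>w\<close> both solve \<open>f w = x\<close>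
  when \<open>x\<close> is real, so they agree.
\<close>

lemma holomorphic_real_inverse:
  assumes holf: "f holomorphic_on S" and S: "open S" "complex_of_real a \<in> S"
    and cnj: "\<And>z. z \<in> S \<Longrightarrow> f (cnj z) = cnj (f z)"
    and dnz: "deriv f (of_real a) \<noteq> 0" and fa: "f (of_real a) = of_real b"
  obtains G d e where "d > 0" "e > 0" "G holomorphic_on ball (of_real b) e"
    "\<And>x. \<bar>x - b\<bar> < e \<Longrightarrow> G (of_real x) \<in> S \<inter> \<real> \<and> f (G (of_real x)) = of_real x"
    "\<And>y. \<bar>y - a\<bar> < d \<Longrightarrow> G (f (of_real y)) = of_real y"
proof -
  obtain d where d: "d > 0" "ball (of_real a) d \<subseteq> S" "open (f ` ball (of_real a) d)"
      "inj_on f (ball (of_real a) d)"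
    using has_complex_derivative_locally_invertible [OF holf S(2,1) dnz] by metis
  have "f holomorphic_on ball (of_real a) d"
    using holf d(2) by (rule holomorphic_on_subset)
  then obtain G where G: "G holomorphic_on f ` ball (of_real a) d"
      "\<And>z. z \<in> ball (of_real a) d \<Longrightarrow> G (f z) = z"
    using holomorphic_has_inverse [OF _ open_ball d(4)] by metis
  have "complex_of_real b \<in> f ` ball (of_real a) d"
    using d(1) fa by (metis centre_in_ball imageI)
  then obtain e where e: "e > 0" "ball (of_real b) e \<subseteq> f ` ball (of_real a) d"
    using d(3) open_contains_ball by blast
  show thesis
  proof (rule that [OF d(1) e(1) holomorphic_on_subset [OF G(1) e(2)]])
    fix x assume "\<bar>x - b\<bar> < e"
    then have "complex_of_real x \<in> ball (of_real b) e"
      by (simp add: dist_of_real dist_real_def abs_minus_commute)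
    then obtain w where w: "w \<in> ball (of_real a) d" "f w = of_real x"
      using e(2) by (metis imageE subsetD)
    have "cnj w \<in> ball (of_real a) d"
      using w(1) by (metis complex_cnj_complex_of_real complex_cnj_diff complex_mod_cnj
          dist_norm mem_ball)
    moreover have "f (cnj w) = f w"
      using cnj [of w] w d(2) by auto
    ultimately have "cnj w = w"
      using d(4) w(1) by (auto dest: inj_onD)
    then have "w \<in> \<real>"
      by (simp add: Reals_cnj_iff)
    moreover have "G (of_real x) = w"
      using G(2) [OF w(1)] w(2) by simp
    ultimately show "G (of_real x) \<in> S \<inter> \<real> \<and> f (G (of_real x)) = of_real x"
      using w d(2) by auto
  next
    fix y assume "\<bar>y - a\<bar> < d"
    then show "G (f (of_real y)) = of_real y"
      by (intro G(2)) (simp add: dist_of_real dist_real_def abs_minus_commute)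
  qed
qed

text \<open>
  These are the classical formulas for reversing a series to third order: \<open>W' = 1 / f' (W)\<close> holds on
  a whole neighbourhood, so it can be differentiated again with the chain rule.
\<close>

lemma higher_derivs_local_inverse:
  fixes f f1 f2 W :: "real \<Rightarrow> real" and f3 :: real
  assumes lim: "(W \<longlongrightarrow> a) (nhds b)"
    and f1: "\<forall>\<^sub>F y in nhds a. (f has_real_derivative f1 y) (at y)"
    and f2: "\<forall>\<^sub>F y in nhds a. (f1 has_real_derivative f2 y) (at y)"
    and f3: "(f2 has_real_derivative f3) (at a)"
    and diff: "\<forall>\<^sub>F x in nhds b. W differentiable at x"
    and inv: "\<forall>\<^sub>F x in nhds b. f (W x) = x"
  shows "deriv W b = 1 / f1 a"
    and "(deriv ^^ 2) W b = - f2 a / f1 a ^ 3"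
    and "(deriv ^^ 3) W b = (3 * f2 a ^ 2 - f1 a * f3) / f1 a ^ 5"
proof -
  have Wb: "W b = a"
    using lim by (metis eventually_nhds_x_imp_x tendsto_nhds_iff)
  have "\<forall>\<^sub>F x in nhds b. (f has_real_derivative f1 (W x)) (at (W x))"
    using f1 lim by (rule eventually_compose_filterlim)
  moreover have "\<forall>\<^sub>F x in nhds b. \<forall>\<^sub>F y in nhds x. f (W y) = y"
    using inv by (simp add: eventually_eventually)
  ultimately have W1: "\<forall>\<^sub>F x in nhds b. f1 (W x) \<noteq> 0 \<and> (W has_real_derivative 1 / f1 (W x)) (at x)"
    using diff
  proof eventually_elim
    case (elim x)
    then have D: "(W has_real_derivative deriv W x) (at x)"
      by (simp add: DERIV_deriv_iff_real_differentiable)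
    have "((\<lambda>x. f (W x)) has_real_derivative f1 (W x) * deriv W x) (at x)"
      using elim(1) D by (rule DERIV_chain2)
    then have "((\<lambda>x. x) has_real_derivative f1 (W x) * deriv W x) (at x)"
      using DERIV_cong_ev [OF refl elim(2) refl] by blast
    then have "f1 (W x) * deriv W x = 1"
      using DERIV_ident DERIV_unique by blast
    \<comment> \<open>This equation also shows that \<open>f1\<close> has no zero among the values of \<open>W\<close> near \<open>b\<close>.\<close>
    then show ?case
      using D by (metis mult_zero_left nonzero_mult_div_cancel_left zero_neq_one)
  qed
  then have dW: "\<forall>\<^sub>F x in nhds b. deriv W x = 1 / f1 (W x)"
    by eventually_elim (auto intro: DERIV_imp_deriv)
  have "\<forall>\<^sub>F x in nhds b. (f1 has_real_derivative f2 (W x)) (at (W x))"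
    using f2 lim by (rule eventually_compose_filterlim)
  moreover have "\<forall>\<^sub>F x in nhds b. \<forall>\<^sub>F y in nhds x. deriv W y = 1 / f1 (W y)"
    using dW by (simp add: eventually_eventually)
  ultimately have ddW: "\<forall>\<^sub>F x in nhds b. deriv (deriv W) x = - f2 (W x) / f1 (W x) ^ 3"
    using W1
  proof eventually_elim
    case (elim x)
    have "((\<lambda>x. 1 / f1 (W x)) has_real_derivative - f2 (W x) / f1 (W x) ^ 3) (at x)"
      using elim(3) DERIV_chain2 [OF elim(1) conjunct2 [OF elim(3)]]
      by (auto intro!: derivative_eq_intros simp: field_simps power3_eq_cube)
    then show ?case
      using deriv_cong_ev [OF elim(2) refl] by (simp add: DERIV_imp_deriv)
  qed
  have at_b: "f1 a \<noteq> 0" "(W has_real_derivative 1 / f1 a) (at b)"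
    using eventually_nhds_x_imp_x [OF W1] Wb by auto
  have f2a: "(f1 has_real_derivative f2 a) (at a)"
    using f2 by (rule eventually_nhds_x_imp_x)
  show "deriv W b = 1 / f1 a"
    using at_b(2) by (rule DERIV_imp_deriv)
  show "(deriv ^^ 2) W b = - f2 a / f1 a ^ 3"
    using eventually_nhds_x_imp_x [OF ddW] Wb by (simp add: numeral_2_eq_2)
  have "((\<lambda>x. f1 (W x)) has_real_derivative f2 a * (1 / f1 a)) (at b)"
    using f2a at_b(2) by (intro DERIV_chain2) (simp_all add: Wb)
  moreover have "((\<lambda>x. f2 (W x)) has_real_derivative f3 * (1 / f1 a)) (at b)"
    using f3 at_b(2) by (intro DERIV_chain2) (simp_all add: Wb)
  ultimately have "((\<lambda>x. - f2 (W x) / f1 (W x) ^ 3) has_real_derivative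
      (3 * f2 a ^ 2 - f1 a * f3) / f1 a ^ 5) (at b)"
    using at_b(1)
    by (auto intro!: derivative_eq_intros simp: Wb field_simps eval_nat_numeral)
  then have "deriv (deriv (deriv W)) b = (3 * f2 a ^ 2 - f1 a * f3) / f1 a ^ 5"
    using deriv_cong_ev [OF ddW refl] by (simp add: DERIV_imp_deriv)
  then show "(deriv ^^ 3) W b = (3 * f2 a ^ 2 - f1 a * f3) / f1 a ^ 5"
    by (simp add: numeral_3_eq_3)
qed

section \<open>The logarithmic Lambert function\<close>

lemma log_lambert_fun_derivs:
  assumes "B * y > 0"
  shows "(log_lambert_fun B has_real_derivative exp y * ((1 + y) * ln (B * y) + 1)) (at y)"
    and "((\<lambda>y. exp y * ((1 + y) * ln (B * y) + 1)) has_real_derivative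
          exp y * ((2 + y) * ln (B * y) + 2 + 1 / y)) (at y)"
    and "((\<lambda>y. exp y * ((2 + y) * ln (B * y) + 2 + 1 / y)) has_real_derivative
          exp y * ((3 + y) * ln (B * y) + 3 + 3 / y - 1 / y ^ 2)) (at y)"
proof -
  have nz: "B \<noteq> 0" "y \<noteq> 0"
    using assms by auto
  have L: "((\<lambda>y. ln (B * y)) has_real_derivative 1 / y) (at y)"
    using assms nz by (auto intro!: derivative_eq_intros simp: field_simps)
  show "(log_lambert_fun B has_real_derivative exp y * ((1 + y) * ln (B * y) + 1)) (at y)"
    unfolding log_lambert_fun_def
    by (rule derivative_eq_intros L refl | use nz in \<open>simp add: field_simps\<close>)+
  show "((\<lambda>y. exp y * ((1 + y) * ln (B * y) + 1)) has_real_derivative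
          exp y * ((2 + y) * ln (B * y) + 2 + 1 / y)) (at y)"
    by (rule derivative_eq_intros L refl | use nz in \<open>simp add: field_simps\<close>)+
  show "((\<lambda>y. exp y * ((2 + y) * ln (B * y) + 2 + 1 / y)) has_real_derivative
          exp y * ((3 + y) * ln (B * y) + 3 + 3 / y - 1 / y ^ 2)) (at y)"
    by (rule derivative_eq_intros L refl
        | use nz in \<open>simp add: field_simps power2_eq_square\<close>)+
qed

text \<open>
  As \<open>W x\<close> tends to \<open>1 / B\<close>, it eventually lies where \<open>G\<close> undoes the complexified function \<open>F\<close>, so
  \<open>F (W x) = x\<close> forces \<open>W x = G x\<close>: the limit condition on a branch is what makes its germ at \<open>0\<close>
  unique.  The side condition \<open>B y > 0\<close> is the trace on the real axis of the half plane
  \<open>Re (B z) > 0\<close>, on which the principal logarithm of \<open>B z\<close> is holomorphic and extends \<open>ln (B y)\<close>;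
  this treats both signs of \<open>B\<close> at once.
\<close>

lemma log_lambert_holomorphic_branch:
  assumes "B \<noteq> 0"
  obtains G e where "e > 0" "G holomorphic_on ball 0 e"
    "is_log_lambert B (\<lambda>x. Re (G (of_real x)))"
    "\<And>W. is_log_lambert B W \<Longrightarrow> \<forall>\<^sub>F x in nhds 0. W x = Re (G (of_real x))"
proof -
  define F where "F = (\<lambda>z. z * Ln (of_real B * z) * exp z)"
  define S where "S = {z. Re (of_real B * z) > 0}"
  have Bz: "of_real B * z \<notin> \<real>\<^sub>\<le>\<^sub>0" if "z \<in> S" for z
    using that by (auto simp: S_def complex_nonpos_Reals_iff)
  have F_of_real: "F (of_real y) = of_real (log_lambert_fun B y)" if "B * y > 0" for y
    using Ln_of_real [OF that] by (simp add: F_def log_lambert_fun_def exp_of_real)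
  have "open S"
    unfolding S_def by (intro open_Collect_less continuous_intros)
  have holF: "F holomorphic_on S"
    unfolding F_def by (intro holomorphic_intros Bz)
  have "complex_of_real (1 / B) \<in> S"
    using assms by (simp add: S_def)
  have cnjF: "F (cnj z) = cnj (F z)" if "z \<in> S" for z
    using cnj_Ln [OF Bz [OF that]] by (simp add: F_def exp_cnj)
  have "(F has_field_derivative exp (of_real (1 / B))) (at (of_real (1 / B)))"
    unfolding F_def using assms by (auto intro!: derivative_eq_intros)
  then have dnz: "deriv F (of_real (1 / B)) \<noteq> 0"
    by (simp add: DERIV_imp_deriv)
  have F0: "F (of_real (1 / B)) = of_real 0"
    using assms by (simp add: F_def)
  obtain G d e where "d > 0" "e > 0" and holG: "G holomorphic_on ball (of_real 0) e"
    and G: "\<And>x. \<bar>x - 0\<bar> < e \<Longrightarrow> G (of_real x) \<in> S \<inter> \<real> \<and> F (G (of_real x)) = of_real x"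
    and GF: "\<And>y. \<bar>y - 1 / B\<bar> < d \<Longrightarrow> G (F (of_real y)) = of_real y"
    by (rule holomorphic_real_inverse
        [OF holF \<open>open S\<close> \<open>complex_of_real (1 / B) \<in> S\<close> cnjF dnz F0],
        assumption) (rule that; assumption)
  show thesis
  proof (rule that)
    show "e > 0" "G holomorphic_on ball 0 e"
      using \<open>e > 0\<close> holG by simp_all
    have "\<forall>\<^sub>F x in nhds 0. \<bar>x\<bar> < e"
      using \<open>e > 0\<close> by (auto simp: eventually_nhds_metric dist_real_def)
    then have "\<forall>\<^sub>F x in nhds 0. Re (G (of_real x)) \<noteq> 0 \<and> B * Re (G (of_real x)) > 0 \<and>
        log_lambert_fun B (Re (G (of_real x))) = x"
    proof eventually_elim
      case (elim x)
      then obtain y where "G (of_real x) = of_real y"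
        using G [of x] by (auto elim: Reals_cases)
      moreover from this have "B * y > 0"
        using G [of x] elim by (simp add: S_def)
      moreover have "F (G (of_real x)) = of_real x"
        using G elim by simp
      ultimately show ?case
        using F_of_real [of y] by auto
    qed
    moreover have "((\<lambda>x. Re (G (of_real x))) \<longlongrightarrow> 1 / B) (nhds 0)"
    proof -
      have "isCont G (of_real 0)"
        using holG \<open>e > 0\<close>
        by (intro continuous_on_interior [OF holomorphic_on_imp_continuous_on]) auto
      then have "isCont (\<lambda>x::real. G (of_real x)) 0"
        by (rule isCont_o2 [rotated]) (rule isCont_of_real [OF continuous_ident])
      then have "isCont (\<lambda>x::real. Re (G (of_real x))) 0"
        by (rule isCont_Re)
      then have "((\<lambda>x::real. Re (G (of_real x))) \<longlongrightarrow> Re (G (of_real 0))) (nhds 0)"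
        unfolding isCont_def
        using tendsto_at_iff_tendsto_nhds [of "\<lambda>x::real. Re (G (of_real x))" 0] by blast
      moreover have "G (of_real 0) = of_real (1 / B)"
        using GF [of "1 / B"] F0 \<open>d > 0\<close> by simp
      ultimately show ?thesis
        by simp
    qed
    ultimately show "is_log_lambert B (\<lambda>x. Re (G (of_real x)))"
      by (simp add: is_log_lambert_def)
  next
    fix W assume W: "is_log_lambert B W"
    then have "(W \<longlongrightarrow> 1 / B) (nhds 0)"
      by (simp add: is_log_lambert_def)
    then have "\<forall>\<^sub>F x in nhds 0. \<bar>W x - 1 / B\<bar> < d"
      using \<open>d > 0\<close> by (simp add: tendsto_iff dist_real_def)
    moreover have "\<forall>\<^sub>F x in nhds 0. W x \<noteq> 0 \<and> B * W x > 0 \<and> log_lambert_fun B (W x) = x"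
      using W by (simp add: is_log_lambert_def)
    ultimately show "\<forall>\<^sub>F x in nhds 0. W x = Re (G (of_real x))"
    proof eventually_elim
      case (elim x)
      then show ?case
        using GF [of "W x"] F_of_real [of "W x"] by simp
    qed
  qed
qed

lemma log_lambert_taylor_coeffs:
  assumes "B \<noteq> 0" and W: "is_log_lambert B W" and diff: "\<forall>\<^sub>F x in nhds 0. W differentiable at x"
  shows "taylor_coeff W 0 = 1 / B"
    and "taylor_coeff W 1 = exp (- (1 / B))"
    and "taylor_coeff W 2 = - ((2 + B) / fact 2 * exp (- (2 / B)))"
    and "taylor_coeff W 3 = (4 * B\<^sup>2 + 9 * B + 9) * exp (- (3 / B)) / fact 3"
proof -
  let ?f1 = "\<lambda>y. exp y * ((1 + y) * ln (B * y) + 1)"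
  let ?f2 = "\<lambda>y. exp y * ((2 + y) * ln (B * y) + 2 + 1 / y)"
  let ?f3 = "\<lambda>y. exp y * ((3 + y) * ln (B * y) + 3 + 3 / y - 1 / y ^ 2)"
  have lim: "(W \<longlongrightarrow> 1 / B) (nhds 0)" and inv: "\<forall>\<^sub>F x in nhds 0. log_lambert_fun B (W x) = x"
    using W by (auto simp: is_log_lambert_def elim: eventually_mono)
  have "open {y. B * y > 0}"
    by (intro open_Collect_less continuous_intros)
  then have "\<forall>\<^sub>F y in nhds (1 / B). y \<in> {y. B * y > 0}"
    using assms(1) by (intro eventually_nhds_in_open) auto
  then have pos: "\<forall>\<^sub>F y in nhds (1 / B). B * y > 0"
    by simp
  have d1: "\<forall>\<^sub>F y in nhds (1 / B). (log_lambert_fun B has_real_derivative ?f1 y) (at y)"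
    using pos by eventually_elim (rule log_lambert_fun_derivs)
  have d2: "\<forall>\<^sub>F y in nhds (1 / B). (?f1 has_real_derivative ?f2 y) (at y)"
    using pos by eventually_elim (rule log_lambert_fun_derivs)
  have d3: "(?f2 has_real_derivative ?f3 (1 / B)) (at (1 / B))"
    using assms(1) by (intro log_lambert_fun_derivs) simp
  note derivs = higher_derivs_local_inverse [OF lim d1 d2 d3 diff inv]
  \<comment> \<open>With \<open>E = e\<^sup>a\<close> as an atom, what remains is rational arithmetic in \<open>E\<close> and \<open>B\<close>.\<close>
  define E where "E = exp (1 / B)"
  have "E \<noteq> 0"
    by (simp add: E_def)
  have fs: "?f1 (1 / B) = E" "?f2 (1 / B) = E * (2 + B)"
      "?f3 (1 / B) = E * (3 + 3 * B - B ^ 2)"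
    using assms(1) by (simp_all add: E_def power2_eq_square)
  have exps: "exp (- (1 / B)) = 1 / E" "exp (- (2 / B)) = 1 / E ^ 2" "exp (- (3 / B)) = 1 / E ^ 3"
    by (simp_all add: E_def exp_minus field_simps flip: exp_of_nat_mult)
  show "taylor_coeff W 0 = 1 / B"
    using lim by (simp add: taylor_coeff_def) (metis eventually_nhds_x_imp_x tendsto_nhds_iff)
  show "taylor_coeff W 1 = exp (- (1 / B))"
    using derivs(1) unfolding fs exps by (simp add: taylor_coeff_def)
  have "- (E * (2 + B)) / E ^ 3 = - ((2 + B) * (1 / E ^ 2))"
    using \<open>E \<noteq> 0\<close> by (simp add: field_simps eval_nat_numeral)
  then show "taylor_coeff W 2 = - ((2 + B) / fact 2 * exp (- (2 / B)))"
    using derivs(2) unfolding fs exps taylor_coeff_def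
    by (simp only: minus_divide_left times_divide_eq_right times_divide_eq_left fact_2 mult_1_right
        divide_divide_eq_left mult.commute)
  have "(3 * (E * (2 + B)) ^ 2 - E * (E * (3 + 3 * B - B ^ 2))) / E ^ 5
      = (4 * B ^ 2 + 9 * B + 9) * E ^ 2 / E ^ 5"
    by (simp add: algebra_simps power2_eq_square)
  also have "\<dots> = (4 * B ^ 2 + 9 * B + 9) * (1 / E ^ 3)"
    using \<open>E \<noteq> 0\<close> by (simp add: eval_nat_numeral)
  finally show "taylor_coeff W 3 = (4 * B\<^sup>2 + 9 * B + 9) * exp (- (3 / B)) / fact 3"
    using derivs(3) unfolding fs exps taylor_coeff_def by simp
qed

theorem theorem2p4:
  fixes B :: real
  assumes "B \<noteq> 0"
  shows "(\<exists>W. is_log_lambert B W) \<and>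
    (\<forall>W. is_log_lambert B W \<longrightarrow>
      (\<exists>r>0. \<forall>x. \<bar>x\<bar> < r \<longrightarrow> (\<lambda>n. taylor_coeff W n * x ^ n) sums W x) \<and>
      taylor_coeff W 0 = 1 / B \<and>
      taylor_coeff W 1 = exp (- (1 / B)) \<and>
      taylor_coeff W 2 = - ((2 + B) / fact 2 * exp (- (2 / B))) \<and>
      taylor_coeff W 3 = (4 * B\<^sup>2 + 9 * B + 9) * exp (- (3 / B)) / fact 3)"
proof -
  obtain G e where "e > 0" and holG: "G holomorphic_on ball 0 e"
    and branch: "is_log_lambert B (\<lambda>x. Re (G (of_real x)))"
    and unique: "\<And>W. is_log_lambert B W \<Longrightarrow> \<forall>\<^sub>F x in nhds 0. W x = Re (G (of_real x))"
    using log_lambert_holomorphic_branch [OF assms] by metis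
  have small: "\<forall>\<^sub>F x::real in nhds 0. \<bar>x\<bar> < e"
    using \<open>e > 0\<close> by (auto simp: eventually_nhds_metric dist_real_def)
  then have "\<forall>\<^sub>F x in nhds 0. (\<lambda>x. Re (G (of_real x))) differentiable at x"
  proof eventually_elim
    case (elim x)
    then have "(G has_field_derivative deriv G (of_real x)) (at (of_real x))"
      by (intro holomorphic_derivI [OF holG]) auto
    then show ?case
      using has_real_derivative_Re_of_real real_differentiable_def by blast
  qed
  note coeffs = log_lambert_taylor_coeffs [OF assms branch this]
  have agree: "taylor_coeff W = taylor_coeff (\<lambda>x. Re (G (of_real x)))"
      and sums: "\<exists>r>0. \<forall>x. \<bar>x\<bar> < r \<longrightarrow> (\<lambda>n. taylor_coeff W n * x ^ n) sums W x" if "is_log_lambert B W" for W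
  proof -
    have tc: "taylor_coeff W n = taylor_coeff (\<lambda>x. Re (G (of_real x))) n" for n
      unfolding taylor_coeff_def using higher_deriv_cong_ev [OF unique [OF that] refl] by simp
    then show "taylor_coeff W = taylor_coeff (\<lambda>x. Re (G (of_real x)))"
      by blast
    have "\<forall>\<^sub>F x in nhds 0. (\<lambda>n. taylor_coeff W n * x ^ n) sums W x"
      using unique [OF that] small
      by eventually_elim (simp add: tc taylor_sums_Re_of_real [OF holG])
    then show "\<exists>r>0. \<forall>x. \<bar>x\<bar> < r \<longrightarrow> (\<lambda>n. taylor_coeff W n * x ^ n) sums W x"
      by (auto simp: eventually_nhds_metric dist_real_def)
  qed
  show ?thesis
  proof (intro conjI allI impI)
    show "\<exists>W. is_log_lambert B W"
      by (intro exI) (rule branch)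
  qed ((rule sums, assumption) | simp only: agree coeffs)+
qed

end
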